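(* For $\alpha>0$ and $x>0$ let $$H_\alpha(x)=\psi(x+\alpha)-\psi(x)-\frac{\alpha}{x}.$$ For every $\alpha>0$ and $x>0$, $$H_\alpha(x)=\alpha(1-\alpha)\sum_{k=0}^{\infty}\frac{1}{(x+k)(x+k+1)(x+k+\alpha)},$$ with locally uniform (on $(0,\infty)$) absolute convergence of the series and of all its termwise derivatives. Consequently: (i) for $0<\alpha<1$, $H_\alpha$ is strictly completely monotone on $(0,\infty)$; (ii) $H_1\equiv 0$, and for $\alpha>1$, $-H_\alpha$ is strictly completely monotone on $(0,\infty)$; in particular $H_\alpha<0$ on $(0,\infty)$ for $\alpha>1$; (iii) for every $\alpha>0$, $H_\alpha(x)=\dfrac{1-\alpha}{x}+O(1)$ as $x\downarrow 0$.
   Context: $\psi=\Gamma'/\Gamma$ is the digamma function. A function $f\in C^\infty(0,\infty)$ is strictly completely monotone if $(-1)^n f^{(n)}(x)>0$ for all integers $n\ge 0$ and all $x>0$. *)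

theory Defs
  imports "HOL-Analysis.Analysis" "HOL-Library.Landau_Symbols"
begin

text \<open>
  The library defines \<^const>\<open>Digamma\<close> by its series; on the positive reals it is the
  logarithmic derivative of \<^const>\<open>Gamma\<close>.
\<close>

lemma Digamma_eq_deriv_Gamma_over_Gamma:
  fixes x :: real
  assumes "x > 0"
  shows "Digamma x = deriv Gamma x / Gamma x"
proof -
  have nonpos: "x \<notin> \<int>\<^sub>\<le>\<^sub>0"
    using assms by (auto elim!: nonpos_Ints_cases)
  have "deriv Gamma x = Gamma x * Digamma x"
    by (rule DERIV_imp_deriv, rule has_field_derivative_Gamma, rule nonpos)
  moreover have "Gamma x \<noteq> 0"
    using assms by (metis Gamma_real_pos less_irrefl)
  ultimately show ?thesis
    by simp
qed

text \<open>
  Since the positive half-line is open, the iterated derivatives at \<open>x > 0\<close> do not depend on the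
  values of \<open>f\<close> at nonpositive arguments. As \<^const>\<open>deriv\<close> is total, smoothness is
  required explicitly.
\<close>

definition smooth_on_pos :: "(real \<Rightarrow> real) \<Rightarrow> bool" where
  "smooth_on_pos f \<longleftrightarrow> (\<forall>n::nat. \<forall>x>0. (deriv ^^ n) f field_differentiable (at x))"

definition strictly_completely_monotone :: "(real \<Rightarrow> real) \<Rightarrow> bool" where
  "strictly_completely_monotone f \<longleftrightarrow>
     smooth_on_pos f \<and> (\<forall>n::nat. \<forall>x>0. (-1) ^ n * (deriv ^^ n) f x > 0)"

definition locally_uniformly_abs_convergent_on ::
    "real set \<Rightarrow> (nat \<Rightarrow> real \<Rightarrow> real) \<Rightarrow> bool" where
  "locally_uniformly_abs_convergent_on S f \<longleftrightarrow>
     (\<forall>x\<in>S. \<exists>e>0. uniformly_convergent_on (ball x e \<inter> S) (\<lambda>N y. \<Sum>k<N. \<bar>f k y\<bar>))"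

definition H :: "real \<Rightarrow> real \<Rightarrow> real" where
  "H \<alpha> x = Digamma (x + \<alpha>) - Digamma x - \<alpha> / x"

definition H_term :: "real \<Rightarrow> nat \<Rightarrow> real \<Rightarrow> real" where
  "H_term \<alpha> k x = 1 / ((x + real k) * (x + real k + 1) * (x + real k + \<alpha>))"

end

theory Submission
  imports Defs
begin

text \<open>
  Subtracting the series of the digamma function at \<open>x\<close> and at \<open>x + \<alpha>\<close>, and writing \<open>\<alpha> / x\<close> as
  the telescoping series of \<open>\<alpha> / (x + k) - \<alpha> / (x + k + 1)\<close>, gives the asserted series for \<open>H \<alpha>\<close>
  by partial fractions: this is \<open>H_sums\<close>.

  Each term of that series is a product of three reciprocals of positive linear functions, so it is
  strictly completely monotone (\<open>alternating_derivs_inverse_shift\<close>, and the Leibniz rule in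
  \<open>alternating_derivs_mult\<close>). A series of strictly completely monotone functions that converges pointwise
  may be differentiated termwise without any further estimate. Indeed, if \<open>(-1)^n f^(n)\<close> is
  positive and decreasing for all \<open>n\<close>, the mean value theorem on \<open>[x/2, x]\<close> bounds
  \<open>(-1)^(n+1) f^(n+1)\<close> at \<open>x\<close> by \<open>2 / x\<close> times \<open>(-1)^n f^(n)\<close> at \<open>x/2\<close>. Hence pointwise convergence
  passes from each derivative to the next one, and monotonicity turns convergence at one point
  into uniform convergence on the half-line to the right of it. So the sum is strictly
  completely monotone (\<open>alternating_derivs_suminf\<close>), and the sign of the factor
  \<open>\<alpha> (1 - \<alpha>)\<close> decides between \<open>H \<alpha>\<close> and \<open>- H \<alpha>\<close>.

  The behaviour at \<open>0\<close> comes from the functional equation instead: it gives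
  \<open>H \<alpha> x - (1 - \<alpha>) / x = \<psi> (x + \<alpha>) - \<psi> (x + 1)\<close>, which is continuous at \<open>x = 0\<close>.
\<close>

section \<open>Sequences of signed derivatives\<close>

text \<open>
  The function \<open>A n\<close> stands for \<open>(-1)^n f^(n)\<close> on the positive half-line. With the sign absorbed,
  every closure property below is about sums and products of positive quantities.
\<close>

definition alternating_derivs :: "(real \<Rightarrow> real) \<Rightarrow> (nat \<Rightarrow> real \<Rightarrow> real) \<Rightarrow> bool" where
  "alternating_derivs f A \<longleftrightarrow>
     (\<forall>x>0. f x = A 0 x) \<and>
     (\<forall>n. \<forall>x>0. A n x > 0 \<and> (A n has_real_derivative - A (Suc n) x) (at x))"

lemma alternating_derivsD:
  assumes "alternating_derivs f A" "x > 0"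
  shows "f x = A 0 x" "A n x > 0" "(A n has_real_derivative - A (Suc n) x) (at x)"
  using assms by (auto simp: alternating_derivs_def)

lemma higher_deriv_eq_alternating_derivs:
  assumes A: "alternating_derivs f A" and "x > 0"
  shows "(deriv ^^ n) f x = (-1) ^ n * A n x"
  using \<open>x > 0\<close>
proof (induction n arbitrary: x)
  case 0
  then show ?case using alternating_derivsD(1)[OF A] by simp
next
  case (Suc n)
  have "((\<lambda>y. (-1) ^ n * A n y) has_real_derivative (-1) ^ n * (- A (Suc n) x)) (at x)"
    by (intro DERIV_cmult alternating_derivsD(3)[OF A] Suc.prems)
  then have "((deriv ^^ n) f has_real_derivative (-1) ^ n * (- A (Suc n) x)) (at x)"
    by (rule has_field_derivative_transform_within_open[where S = "{0<..}"])
       (use Suc in auto)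
  then show ?case by (simp add: DERIV_imp_deriv)
qed

lemma alternating_derivs_imp_strictly_completely_monotone:
  assumes A: "alternating_derivs f A"
  shows "strictly_completely_monotone f"
  unfolding strictly_completely_monotone_def smooth_on_pos_def
proof (intro conjI allI impI)
  fix n :: nat and x :: real assume x: "x > 0"
  have "((\<lambda>y. (-1) ^ n * A n y) has_real_derivative (-1) ^ n * (- A (Suc n) x)) (at x)"
    by (intro DERIV_cmult alternating_derivsD(3)[OF A] x)
  then have "((deriv ^^ n) f has_real_derivative (-1) ^ n * (- A (Suc n) x)) (at x)"
    by (rule has_field_derivative_transform_within_open[where S = "{0<..}"])
       (use x higher_deriv_eq_alternating_derivs[OF A] in auto)
  then show "(deriv ^^ n) f field_differentiable at x"
    by (auto simp: field_differentiable_def)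
  show "(-1) ^ n * (deriv ^^ n) f x > 0"
    using alternating_derivsD(2)[OF A x]
    by (simp add: higher_deriv_eq_alternating_derivs[OF A x] flip: mult.assoc power_mult_distrib)
qed

lemma alternating_derivs_antimono:
  assumes A: "alternating_derivs f A" and "0 < x" "x \<le> y"
  shows "A n y \<le> A n x"
proof (rule DERIV_nonpos_imp_nonincreasing[OF \<open>x \<le> y\<close>])
  fix t assume "x \<le> t" "t \<le> y"
  then have "t > 0" using \<open>0 < x\<close> by simp
  then show "\<exists>d. (A n has_real_derivative d) (at t) \<and> d \<le> 0"
    using alternating_derivsD(2,3)[OF A, of t] less_imp_le by fastforce
qed

text \<open>
  The drop of \<open>A n\<close> over \<open>[x/2, x]\<close> is at least the length of the interval times the smallest
  slope \<open>A (n + 1) x\<close>, and at most \<open>A n (x/2)\<close> since \<open>A n x\<close> is positive.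
\<close>

lemma alternating_derivs_Suc_le:
  assumes A: "alternating_derivs f A" and x: "x > 0"
  shows "A (Suc n) x \<le> 2 / x * A n (x / 2)"
proof -
  obtain z where z: "x / 2 < z" "z < x" "A n x - A n (x / 2) = (x - x / 2) * (- A (Suc n) z)"
    using MVT2[of "x / 2" x "A n" "\<lambda>t. - A (Suc n) t"] alternating_derivsD(3)[OF A] x by auto
  have "x / 2 * A (Suc n) x \<le> x / 2 * A (Suc n) z"
    using alternating_derivs_antimono[OF A, of z x] z x by (intro mult_left_mono) auto
  also have "\<dots> = A n (x / 2) - A n x" using z(3) by (simp add: field_simps)
  also have "\<dots> \<le> A n (x / 2)" using alternating_derivsD(2)[OF A x, of n] by simp
  finally show ?thesis using x by (simp add: field_simps)
qed

section \<open>Closure properties\<close>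

lemma alternating_derivs_inverse_shift:
  assumes "c \<ge> 0"
  shows "alternating_derivs (\<lambda>x. 1 / (x + c)) (\<lambda>n x. fact n / (x + c) ^ Suc n)"
  unfolding alternating_derivs_def
proof (intro conjI allI impI)
  fix n :: nat and x :: real assume "x > 0"
  then have "x + c > 0" using assms by simp
  then show "fact n / (x + c) ^ Suc n > 0" by simp
  show "((\<lambda>x. fact n / (x + c) ^ Suc n) has_real_derivative
          - (fact (Suc n) / (x + c) ^ Suc (Suc n))) (at x)"
    by (rule derivative_eq_intros refl)+
       (use \<open>x + c > 0\<close> in \<open>simp_all add: divide_simps\<close>)
qed simp

lemma alternating_derivs_cmult:
  assumes A: "alternating_derivs f A" and "c > 0"
  shows "alternating_derivs (\<lambda>x. c * f x) (\<lambda>n x. c * A n x)"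
  using alternating_derivsD[OF A] \<open>c > 0\<close> DERIV_cmult[of "A _" "- A (Suc _) _" _ UNIV c]
  by (auto simp: alternating_derivs_def)

text \<open>
  In the Leibniz rule the signs of the two factors multiply to \<open>(-1)^n\<close> in every summand, so nothing
  cancels and positivity is preserved.
\<close>

lemma alternating_derivs_mult:
  assumes A: "alternating_derivs f A" and B: "alternating_derivs g B"
  shows "alternating_derivs (\<lambda>x. f x * g x)
           (\<lambda>n x. \<Sum>i\<le>n. real (n choose i) * A i x * B (n - i) x)"
  unfolding alternating_derivs_def
proof (intro conjI allI impI)
  fix x :: real assume x: "x > 0"
  show "f x * g x = (\<Sum>i\<le>0. real (0 choose i) * A i x * B (0 - i) x)"
    using alternating_derivsD(1)[OF A x] alternating_derivsD(1)[OF B x] by simp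
next
  fix n :: nat and x :: real assume x: "x > 0"
  note pos = alternating_derivsD(2)[OF A x] alternating_derivsD(2)[OF B x]
  show "(\<Sum>i\<le>n. real (n choose i) * A i x * B (n - i) x) > 0"
    by (rule sum_pos) (auto intro!: mult_pos_pos pos)
  have "((\<lambda>x. \<Sum>i\<le>n. real (n choose i) * A i x * B (n - i) x) has_real_derivative
      (\<Sum>i\<le>n. - (real (n choose i) * (A (Suc i) x * B (n - i) x + A i x * B (Suc n - i) x)))) (at x)"
    by (rule DERIV_sum)
       (auto intro!: derivative_eq_intros alternating_derivsD(3)[OF A x]
          alternating_derivsD(3)[OF B x] simp: algebra_simps Suc_diff_le)
  also have "(\<Sum>i\<le>n. - (real (n choose i) * (A (Suc i) x * B (n - i) x + A i x * B (Suc n - i) x)))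
      = - (\<Sum>i\<le>Suc n. real (Suc n choose i) * A i x * B (Suc n - i) x)"
  proof -
    have "(\<Sum>i\<le>Suc n. real (Suc n choose i) * A i x * B (Suc n - i) x) =
        A 0 x * B (Suc n) x +
        (\<Sum>i\<le>n. real (Suc n choose Suc i) * A (Suc i) x * B (n - i) x)"
      by (subst sum.atMost_Suc_shift) simp
    also have "(\<Sum>i\<le>n. real (Suc n choose Suc i) * A (Suc i) x * B (n - i) x) =
        (\<Sum>i\<le>n. real (n choose i) * A (Suc i) x * B (n - i) x) +
        (\<Sum>i\<le>n. real (n choose Suc i) * A (Suc i) x * B (n - i) x)"
      by (simp add: algebra_simps sum.distrib)
    also have "A 0 x * B (Suc n) x +
        ((\<Sum>i\<le>n. real (n choose i) * A (Suc i) x * B (n - i) x) +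
         (\<Sum>i\<le>n. real (n choose Suc i) * A (Suc i) x * B (n - i) x)) =
        (\<Sum>i\<le>n. real (n choose i) * A (Suc i) x * B (n - i) x) +
        (\<Sum>i\<le>Suc n. real (n choose i) * A i x * B (Suc n - i) x)"
      using sum.atMost_Suc_shift[of "\<lambda>i. real (n choose i) * A i x * B (Suc n - i) x" n] by simp
    also have "(\<Sum>i\<le>Suc n. real (n choose i) * A i x * B (Suc n - i) x) =
        (\<Sum>i\<le>n. real (n choose i) * A i x * B (Suc n - i) x)"
      by simp
    finally show ?thesis
      by (simp add: sum.distrib sum_negf sum_subtractf ring_distribs mult.assoc
          del: sum.atMost_Suc binomial_Suc_Suc)
  qed
  finally show "((\<lambda>x. \<Sum>i\<le>n. real (n choose i) * A i x * B (n - i) x) has_real_derivative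
      - (\<Sum>i\<le>Suc n. real (Suc n choose i) * A i x * B (Suc n - i) x)) (at x)" .
qed

section \<open>Series of completely monotone functions\<close>

lemma summable_alternating_derivs:
  assumes A: "\<And>k. alternating_derivs (f k) (A k)"
    and f: "\<And>x. x > 0 \<Longrightarrow> summable (\<lambda>k. f k x)" and "x > 0"
  shows "summable (\<lambda>k. A k n x)"
  using \<open>x > 0\<close>
proof (induction n arbitrary: x)
  case 0
  then show ?case using f[of x] alternating_derivsD(1)[OF A] by simp
next
  case (Suc n)
  then have "summable (\<lambda>k. 2 / x * A k n (x / 2))" by (intro summable_mult) simp
  then show ?case
    by (rule summable_comparison_test'[where N = 0])
       (use alternating_derivs_Suc_le[OF A Suc.prems] alternating_derivsD(2)[OF A Suc.prems] in
         \<open>simp add: abs_of_pos\<close>)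
qed

lemma uniformly_convergent_on_alternating_derivs:
  assumes A: "\<And>k. alternating_derivs (f k) (A k)"
    and f: "\<And>x. x > 0 \<Longrightarrow> summable (\<lambda>k. f k x)" and "a > 0"
  shows "uniformly_convergent_on {a<..} (\<lambda>N x. \<Sum>k<N. A k n x)"
proof (rule Weierstrass_m_test')
  show "summable (\<lambda>k. A k n a)"
    by (rule summable_alternating_derivs[OF A f \<open>a > 0\<close>])
  fix k x assume "x \<in> {a<..}"
  then show "norm (A k n x) \<le> A k n a"
    using alternating_derivs_antimono[OF A, of a x k n] alternating_derivsD(2)[OF A, of x k n]
      \<open>a > 0\<close> by simp
qed

lemma locally_uniformly_abs_convergent_higher_derivs:
  assumes A: "\<And>k. alternating_derivs (f k) (A k)"
    and f: "\<And>x. x > 0 \<Longrightarrow> summable (\<lambda>k. f k x)"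
  shows "locally_uniformly_abs_convergent_on {0<..} (\<lambda>k. (deriv ^^ n) (f k))"
  unfolding locally_uniformly_abs_convergent_on_def
proof
  fix x :: real assume x: "x \<in> {0<..}"
  let ?U = "ball x (x / 2) \<inter> {0<..}"
  have "?U \<subseteq> {x/2<..}" by (auto simp: dist_real_def abs_if split: if_splits)
  moreover have "uniformly_convergent_on {x/2<..} (\<lambda>N y. \<Sum>k<N. A k n y)"
    using uniformly_convergent_on_alternating_derivs[OF A f] x by simp
  ultimately have "uniformly_convergent_on ?U (\<lambda>N y. \<Sum>k<N. A k n y)"
    by (metis uniformly_convergent_on_subset)
  also have "?this \<longleftrightarrow> uniformly_convergent_on ?U (\<lambda>N y. \<Sum>k<N. \<bar>(deriv ^^ n) (f k) y\<bar>)"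
  proof (intro uniformly_convergent_cong always_eventually allI ballI refl sum.cong)
    fix y k assume "y \<in> ?U"
    then show "A k n y = \<bar>(deriv ^^ n) (f k) y\<bar>"
      using alternating_derivsD(2)[OF A, of y k n]
      by (simp add: higher_deriv_eq_alternating_derivs[OF A] abs_mult)
  qed
  finally show "\<exists>e>0. uniformly_convergent_on (ball x e \<inter> {0<..})
      (\<lambda>N y. \<Sum>k<N. \<bar>(deriv ^^ n) (f k) y\<bar>)"
    using x by (intro exI[of _ "x / 2"]) auto
qed

lemma alternating_derivs_suminf:
  assumes A: "\<And>k. alternating_derivs (f k) (A k)"
    and f: "\<And>x. x > 0 \<Longrightarrow> summable (\<lambda>k. f k x)"
  shows "alternating_derivs (\<lambda>x. \<Sum>k. f k x) (\<lambda>n x. \<Sum>k. A k n x)"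
  unfolding alternating_derivs_def
proof (intro conjI allI impI)
  fix x :: real assume "x > 0"
  then show "(\<Sum>k. f k x) = (\<Sum>k. A k 0 x)"
    using alternating_derivsD(1)[OF A] by simp
next
  fix n :: nat and x :: real assume x: "x > 0"
  have S: "summable (\<lambda>k. A k m y)" if "y > 0" for m y
    by (rule summable_alternating_derivs[OF A f that])
  show "(\<Sum>k. A k n x) > 0"
    by (intro suminf_pos S x alternating_derivsD(2)[OF A])
  have "uniformly_convergent_on {x/2<..} (\<lambda>N y. \<Sum>k<N. - A k (Suc n) y)"
    using uniformly_convergent_on_alternating_derivs[OF A f, of "x / 2" "Suc n"] x
    by (auto simp: sum_negf uniformly_convergent_on_def dest: uniform_limit_uminus)
  then have "((\<lambda>y. \<Sum>k. A k n y) has_real_derivative (\<Sum>k. - A k (Suc n) x)) (at x)"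
    by (intro has_field_derivative_series'(2)[where S = "{x/2<..}" and x0 = x]
          has_field_derivative_at_within[OF alternating_derivsD(3)[OF A]] S)
       (use x in \<open>auto simp: interior_open\<close>)
  then show "((\<lambda>y. \<Sum>k. A k n y) has_real_derivative - (\<Sum>k. A k (Suc n) x)) (at x)"
    using suminf_minus[OF S[OF x]] by simp
qed

section \<open>The digamma difference\<close>

lemma tendsto_inverse_add_nat: "(\<lambda>k. 1 / (x + real k)) \<longlonglongrightarrow> 0"
  by (intro tendsto_divide_0[OF tendsto_const] tendsto_add_filterlim_at_infinity[OF tendsto_const]
      tendsto_of_nat)

lemma inverse_add_nat_telescope_sums:
  "(\<lambda>k. 1 / (x + real k) - 1 / (x + real k + 1)) sums (1 / x)"
  using telescope_sums'[OF tendsto_inverse_add_nat[of x]] by (simp add: add_ac)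

text \<open>
  The first two factors of \<open>H_term \<alpha> k x\<close> form the \<open>k\<close>-th term of the telescoping series, and the
  third one is at most \<open>1 / \<alpha>\<close>. Summability cannot be read off the expansion of \<open>H \<alpha>\<close>, whose
  coefficient \<open>\<alpha> (1 - \<alpha>)\<close> vanishes at \<open>\<alpha> = 1\<close>.
\<close>

lemma summable_H_term:
  assumes "\<alpha> > 0" "x > 0"
  shows "summable (\<lambda>k. H_term \<alpha> k x)"
proof (rule summable_comparison_test'[where N = 0])
  show "summable (\<lambda>k. 1 / \<alpha> * (1 / (x + real k) - 1 / (x + real k + 1)))"
    using inverse_add_nat_telescope_sums[of x] by (intro summable_mult) (simp add: sums_iff)
  fix k :: nat
  have pos: "x + real k > 0" "x + real k + 1 > 0" "x + real k + \<alpha> > 0"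
    using assms by (auto intro: add_pos_nonneg)
  have "H_term \<alpha> k x = 1 / (x + real k + \<alpha>) * (1 / (x + real k) - 1 / (x + real k + 1))"
    using pos by (simp add: H_term_def divide_simps)
  also have "\<dots> \<le> 1 / \<alpha> * (1 / (x + real k) - 1 / (x + real k + 1))"
    using assms pos by (intro mult_right_mono frac_le) (auto simp: divide_simps)
  finally show "norm (H_term \<alpha> k x) \<le> 1 / \<alpha> * (1 / (x + real k) - 1 / (x + real k + 1))"
    using pos by (simp add: H_term_def)
qed

text \<open>
  With \<open>u = x + k\<close> the three series combine termwise to
  \<open>1 / u - 1 / (u + \<alpha>) - \<alpha> (1 / u - 1 / (u + 1))\<close>, which is
  \<open>\<alpha> / (u (u + \<alpha>)) - \<alpha> / (u (u + 1))\<close>; this difference produces the factor \<open>1 - \<alpha>\<close>.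
\<close>

lemma H_sums:
  assumes "\<alpha> > 0" "x > 0"
  shows "(\<lambda>k. \<alpha> * (1 - \<alpha>) * H_term \<alpha> k x) sums H \<alpha> x"
proof -
  have D: "(\<lambda>k. inverse (real (Suc k)) - inverse (z + real k)) sums (Digamma z + euler_mascheroni)"
    if "z > 0" for z :: real
    using summable_sums[OF summable_Digamma[of z]] that by (simp add: Digamma_def)
  have "(\<lambda>k. (inverse (real (Suc k)) - inverse (x + \<alpha> + real k))
            - (inverse (real (Suc k)) - inverse (x + real k))
            - \<alpha> * (1 / (x + real k) - 1 / (x + real k + 1)))
        sums ((Digamma (x + \<alpha>) + euler_mascheroni) - (Digamma x + euler_mascheroni) - \<alpha> * (1 / x))"
    using assms by (intro sums_diff sums_mult D inverse_add_nat_telescope_sums) auto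
  also have "(Digamma (x + \<alpha>) + euler_mascheroni) - (Digamma x + euler_mascheroni) - \<alpha> * (1 / x)
      = H \<alpha> x"
    by (simp add: H_def)
  also have "(\<lambda>k. (inverse (real (Suc k)) - inverse (x + \<alpha> + real k))
            - (inverse (real (Suc k)) - inverse (x + real k))
            - \<alpha> * (1 / (x + real k) - 1 / (x + real k + 1)))
      = (\<lambda>k. \<alpha> * (1 - \<alpha>) * H_term \<alpha> k x)"
  proof
    fix k
    define u where "u = x + real k"
    have u: "u > 0" "u + 1 > 0" "u + \<alpha> > 0" using assms by (auto simp: u_def)
    have "1 / u - 1 / (u + \<alpha>) - \<alpha> * (1 / u - 1 / (u + 1)) =
        \<alpha> * (1 - \<alpha>) * (1 / (u * (u + 1) * (u + \<alpha>)))"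
      using u by (simp add: divide_simps) (simp add: algebra_simps)
    then show "(inverse (real (Suc k)) - inverse (x + \<alpha> + real k))
            - (inverse (real (Suc k)) - inverse (x + real k))
            - \<alpha> * (1 / (x + real k) - 1 / (x + real k + 1)) = \<alpha> * (1 - \<alpha>) * H_term \<alpha> k x"
      by (simp add: H_term_def u_def inverse_eq_divide add_ac)
  qed
  finally show ?thesis .
qed

lemma H_eq_suminf:
  assumes "\<alpha> > 0" "x > 0"
  shows "H \<alpha> x = \<alpha> * (1 - \<alpha>) * (\<Sum>k. H_term \<alpha> k x)"
  using sums_unique[OF H_sums[OF assms]] suminf_mult[OF summable_H_term[OF assms]] by simp

lemma ex_alternating_derivs_H_term:
  assumes "\<alpha> > 0"
  shows "\<exists>A. alternating_derivs (H_term \<alpha> k) A"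
proof -
  have "H_term \<alpha> k =
      (\<lambda>x. 1 / (x + real k) * (1 / (x + (real k + 1))) * (1 / (x + (real k + \<alpha>))))"
    by (simp add: H_term_def fun_eq_iff add_ac)
  then show ?thesis
    using alternating_derivs_mult[OF alternating_derivs_mult[OF
        alternating_derivs_inverse_shift[of "real k"]
        alternating_derivs_inverse_shift[of "real k + 1"]]
        alternating_derivs_inverse_shift[of "real k + \<alpha>"]] assms by auto
qed

text \<open>
  The cases \<open>c = 1\<close> and \<open>c = - 1\<close> treat \<open>\<alpha> < 1\<close> and \<open>\<alpha> > 1\<close> at once.
\<close>

lemma strictly_completely_monotone_H_multiple:
  assumes "\<alpha> > 0" and c: "c * (\<alpha> * (1 - \<alpha>)) > 0"
  shows "strictly_completely_monotone (\<lambda>x. c * H \<alpha> x)"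
proof -
  obtain A where A: "\<And>k. alternating_derivs (H_term \<alpha> k) (A k)"
    using ex_alternating_derivs_H_term[OF \<open>\<alpha> > 0\<close>] by metis
  have "alternating_derivs (\<lambda>x. c * (\<alpha> * (1 - \<alpha>)) * (\<Sum>k. H_term \<alpha> k x))
      (\<lambda>n x. c * (\<alpha> * (1 - \<alpha>)) * (\<Sum>k. A k n x))"
    by (intro alternating_derivs_cmult alternating_derivs_suminf A summable_H_term assms)
  then have "alternating_derivs (\<lambda>x. c * H \<alpha> x) (\<lambda>n x. c * (\<alpha> * (1 - \<alpha>)) * (\<Sum>k. A k n x))"
    using H_eq_suminf[OF \<open>\<alpha> > 0\<close>] by (simp add: alternating_derivs_def mult.assoc)
  then show ?thesis
    by (rule alternating_derivs_imp_strictly_completely_monotone)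
qed

lemma H_eq_Digamma_diff:
  assumes "x > 0"
  shows "H \<alpha> x - (1 - \<alpha>) / x = Digamma (x + \<alpha>) - Digamma (x + 1)"
  using assms Digamma_plus1[of x] by (simp add: H_def diff_divide_distrib)

lemma H_asymptotics_at_0:
  assumes "\<alpha> > 0"
  shows "(\<lambda>x. H \<alpha> x - (1 - \<alpha>) / x) \<in> O[at_right 0](\<lambda>_. 1)"
proof -
  have "((\<lambda>x. Digamma (x + \<alpha>) - Digamma (x + 1)) \<longlongrightarrow> Digamma (0 + \<alpha>) - Digamma (0 + 1)) (at_right 0)"
    using assms by (intro tendsto_intros) (auto elim!: nonpos_Ints_cases)
  moreover have "\<forall>\<^sub>F x in at_right 0. Digamma (x + \<alpha>) - Digamma (x + 1) = H \<alpha> x - (1 - \<alpha>) / x"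
    using eventually_at_right_less by eventually_elim (simp add: H_eq_Digamma_diff)
  ultimately have "((\<lambda>x. H \<alpha> x - (1 - \<alpha>) / x) \<longlongrightarrow> Digamma (0 + \<alpha>) - Digamma (0 + 1)) (at_right 0)"
    by (rule Lim_transform_eventually)
  then show ?thesis
    by (intro bigoI_tendsto[where c = "Digamma (0 + \<alpha>) - Digamma (0 + 1)"]) auto
qed

theorem theorem3p1:
  "(\<forall>\<alpha>>0.
      (\<forall>x>0. H \<alpha> x = \<alpha> * (1 - \<alpha>) * (\<Sum>k. H_term \<alpha> k x)) \<and>
      (\<forall>n::nat. locally_uniformly_abs_convergent_on {0<..}
                  (\<lambda>k. (deriv ^^ n) (H_term \<alpha> k)))) \<and>
   (\<forall>\<alpha>. 0 < \<alpha> \<and> \<alpha> < 1 \<longrightarrow> strictly_completely_monotone (H \<alpha>)) \<and>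
   (\<forall>x>0. H 1 x = 0) \<and>
   (\<forall>\<alpha>>1. strictly_completely_monotone (\<lambda>x. - H \<alpha> x) \<and> (\<forall>x>0. H \<alpha> x < 0)) \<and>
   (\<forall>\<alpha>>0. (\<lambda>x. H \<alpha> x - (1 - \<alpha>) / x) \<in> O[at_right 0](\<lambda>_. 1))"
proof (intro conjI allI impI)
  fix \<alpha> x :: real assume "\<alpha> > 0" "x > 0"
  then show "H \<alpha> x = \<alpha> * (1 - \<alpha>) * (\<Sum>k. H_term \<alpha> k x)" by (rule H_eq_suminf)
next
  fix \<alpha> :: real and n assume \<alpha>: "\<alpha> > 0"
  obtain A where "\<And>k. alternating_derivs (H_term \<alpha> k) (A k)"
    using ex_alternating_derivs_H_term[OF \<alpha>] by metis
  then show "locally_uniformly_abs_convergent_on {0<..} (\<lambda>k. (deriv ^^ n) (H_term \<alpha> k))"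
    by (rule locally_uniformly_abs_convergent_higher_derivs[OF _ summable_H_term[OF \<alpha>]])
next
  fix \<alpha> :: real assume "0 < \<alpha> \<and> \<alpha> < 1"
  then show "strictly_completely_monotone (H \<alpha>)"
    using strictly_completely_monotone_H_multiple[of \<alpha> 1] by simp
next
  fix x :: real assume "x > 0"
  then show "H 1 x = 0" using H_eq_suminf[of 1 x] by simp
next
  fix \<alpha> :: real assume "\<alpha> > 1"
  then show cm: "strictly_completely_monotone (\<lambda>x. - H \<alpha> x)"
    using strictly_completely_monotone_H_multiple[of \<alpha> "-1"] by (simp add: mult_pos_neg)
  fix x :: real assume "x > 0"
  then have "(-1) ^ 0 * (deriv ^^ 0) (\<lambda>x. - H \<alpha> x) x > 0"
    using cm unfolding strictly_completely_monotone_def by blast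
  then show "H \<alpha> x < 0" by simp
next
  fix \<alpha> :: real assume "\<alpha> > 0"
  then show "(\<lambda>x. H \<alpha> x - (1 - \<alpha>) / x) \<in> O[at_right 0](\<lambda>_. 1)" by (rule H_asymptotics_at_0)
qed

end
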